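(* Let $A\in\mathbb{R}^{n\times n}$ be symmetric positive definite with eigenvalues $0<\lambda_1\le\lambda_2\le\dots\le\lambda_n$ and condition number $\kappa=\lambda_n/\lambda_1$, let $b\in\mathbb{R}^n$, $c\in\mathbb{R}$, and $f(x)=\frac12x^TAx-b^Tx+c$. Let $x_0\in\mathbb{R}^n$ be any initial point. Then MomME started at $x_0$ generates a sequence $(x_k)_{k\ge0}\subset\mathbb{R}^n$ that converges to $x_*$, the unique minimizer of $f$. Moreover, the convergence is linear: there is a real number $\eta$ with $$0\le\eta\le\frac{(\kappa-1)^4}{(\kappa^2+6\kappa+1)^2}$$ such that for all $k\ge0$, $$f(x_k)-f(x_* )\le\eta^k\,(f(x_0)-f(x_* ))\qquad\text{and}\qquad\|x_k-x_*\|_A\le\sqrt{\eta^k}\,\|x_0-x_*\|_A.$$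
   Context: Notation: $\|x\|_A=\sqrt{x^TAx}$, $\|\cdot\|$ is the Euclidean norm, $\nabla f(x)=Ax-b$, and $0^0=1$. MomME (method of ellipcenters with momentum) with initial point $x_0$: set $g_0=\nabla f(x_0)$. For $k=0,1,2,\dots$, as long as $g_k\ne0$, perform iteration $k$: - $w_k=Ag_k$, $t_k=\dfrac{2\|g_k\|^2}{g_k^Tw_k}$, $y_k=x_k-t_kg_k$, $r_k=g_k-t_kw_k$. - If $g_k$ and $r_k$ are linearly independent, let $(\alpha_k,\beta_k)$ be the minimizer over $(\alpha,\beta)\in\mathbb{R}^2$ of $f(x_k+\alpha g_k+\beta r_k)$ and set $\tilde x_{k+1}=x_k+\alpha_kg_k+\beta_kr_k$. Then: if $k=0$, set $x_1=\tilde x_1$ and $g_1=\nabla f(\tilde x_1)$; if $k\ge1$, set $\tilde s_{k-1}=\tilde x_{k+1}-x_{k-1}$, $\tilde v_{k-1}=\nabla f(\tilde x_{k+1})-g_{k-1}$, $$\mu_k=\frac{\nabla f(\tilde x_{k+1})^T\tilde s_{k-1}}{\tilde s_{k-1}^T\tilde v_{k-1}},$$ $x_{k+1}=(1-\mu_k)\tilde x_{k+1}+\mu_kx_{k-1}$ and $g_{k+1}=(1-\mu_k)\nabla f(\tilde x_{k+1})+\mu_kg_{k-1}$. - If $g_k$ and $r_k$ are linearly dependent, set $\tilde x_{k+1}=\frac12(x_k+y_k)$, $x_{k+1}=\tilde x_{k+1}$, $g_{k+1}=\nabla f(\tilde x_{k+1})$, and stop. If the method stops with last computed iterate $x_K$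 (either because $g_K=0$ or after the linearly dependent case), set $x_k=x_K$ for all $k\ge K$. *)

theory Defs
  imports "HOL-Analysis.Analysis"
begin

definition sym_pos_def :: "real^'n^'n \<Rightarrow> bool" where
  "sym_pos_def A \<longleftrightarrow> transpose A = A \<and> (\<forall>v. v \<noteq> 0 \<longrightarrow> 0 < v \<bullet> (A *v v))"

definition eigenvalues :: "real^'n^'n \<Rightarrow> real set" where
  "eigenvalues A = {l. \<exists>v. v \<noteq> 0 \<and> A *v v = l *\<^sub>R v}"

text \<open>
  The ratio of the largest to the smallest eigenvalue. Only meaningful for matrices whose set of
  real eigenvalues is nonempty and whose smallest eigenvalue is nonzero, in particular for
  symmetric positive definite ones.
\<close>
definition cond_number :: "real^'n^'n \<Rightarrow> real" where
  "cond_number A = Max (eigenvalues A) / Min (eigenvalues A)"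

definition quad :: "real^'n^'n \<Rightarrow> real^'n \<Rightarrow> real \<Rightarrow> real^'n \<Rightarrow> real" where
  "quad A b c x = 1/2 * (x \<bullet> (A *v x)) - b \<bullet> x + c"

definition grad_quad :: "real^'n^'n \<Rightarrow> real^'n \<Rightarrow> real^'n \<Rightarrow> real^'n" where
  "grad_quad A b x = A *v x - b"

definition norm_wrt :: "real^'n^'n \<Rightarrow> real^'n \<Rightarrow> real" where
  "norm_wrt A x = sqrt (x \<bullet> (A *v x))"

text \<open>
  The requirement \<open>u \<noteq> v\<close> is needed because \<open>independent\<close> speaks about sets: the pair
  \<open>(u, u)\<close> is linearly dependent, although the set \<open>{u, u} = {u}\<close> may be independent.
\<close>
definition lin_indep_pair :: "real^'n \<Rightarrow> real^'n \<Rightarrow> bool" where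
  "lin_indep_pair u v \<longleftrightarrow> u \<noteq> v \<and> independent {u, v}"

definition momme_t :: "real^'n^'n \<Rightarrow> real^'n \<Rightarrow> real" where
  "momme_t A g = 2 * (norm g)\<^sup>2 / (g \<bullet> (A *v g))"

definition momme_y :: "real^'n^'n \<Rightarrow> real^'n \<Rightarrow> real^'n \<Rightarrow> real^'n" where
  "momme_y A x g = x - momme_t A g *\<^sub>R g"

definition momme_r :: "real^'n^'n \<Rightarrow> real^'n \<Rightarrow> real^'n" where
  "momme_r A g = g - momme_t A g *\<^sub>R (A *v g)"

definition plane_obj ::
    "real^'n^'n \<Rightarrow> real^'n \<Rightarrow> real \<Rightarrow> real^'n \<Rightarrow> real^'n \<Rightarrow> real \<times> real \<Rightarrow> real" where
  "plane_obj A b c x g =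
     (\<lambda>(\<alpha>, \<beta>). quad A b c (x + \<alpha> *\<^sub>R g + \<beta> *\<^sub>R momme_r A g))"

definition momme_tilde ::
    "real^'n^'n \<Rightarrow> real^'n \<Rightarrow> real \<Rightarrow> real^'n \<Rightarrow> real^'n \<Rightarrow> real^'n" where
  "momme_tilde A b c x g =
     (if lin_indep_pair g (momme_r A g)
      then let (\<alpha>, \<beta>) = arg_min (plane_obj A b c x g) (\<lambda>_. True)
           in x + \<alpha> *\<^sub>R g + \<beta> *\<^sub>R momme_r A g
      else (1/2) *\<^sub>R (x + momme_y A x g))"

text \<open>
  In the following two definitions \<open>xt\<close> is the tentative point computed from the current iterate,
  and \<open>xp\<close>, \<open>gp\<close> are the iterate and the gradient that precede the current ones.
\<close>
definition momme_den :: "real^'n^'n \<Rightarrow> real^'n \<Rightarrow> real^'n \<Rightarrow> real^'n \<Rightarrow> real^'n \<Rightarrow> real" where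
  "momme_den A b xt xp gp = (xt - xp) \<bullet> (grad_quad A b xt - gp)"

definition momme_mu :: "real^'n^'n \<Rightarrow> real^'n \<Rightarrow> real^'n \<Rightarrow> real^'n \<Rightarrow> real^'n \<Rightarrow> real" where
  "momme_mu A b xt xp gp = grad_quad A b xt \<bullet> (xt - xp) / momme_den A b xt xp gp"

text \<open>
  The flag \<open>halted\<close> records that the linearly dependent case has occurred. The other way
  to stop, a vanishing gradient, is read off from \<open>gradient\<close>.
\<close>
record 'v momme_state =
  iterate :: 'v
  gradient :: 'v
  halted :: bool

definition running :: "('v::zero) momme_state \<Rightarrow> bool" where
  "running s \<longleftrightarrow> \<not> halted s \<and> gradient s \<noteq> 0"

text \<open>
  One iteration. The first state argument is the preceding state, which does not exist in
  iteration 0. Once the method has stopped, the state is repeated forever.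
\<close>
definition momme_step ::
    "real^'n^'n \<Rightarrow> real^'n \<Rightarrow> real \<Rightarrow> (real^'n) momme_state option \<Rightarrow> (real^'n) momme_state
       \<Rightarrow> (real^'n) momme_state" where
  "momme_step A b c prev s =
     (if running s then
        let xt = momme_tilde A b c (iterate s) (gradient s)
        in if lin_indep_pair (gradient s) (momme_r A (gradient s)) then
             (case prev of
                None \<Rightarrow> \<lparr>iterate = xt, gradient = grad_quad A b xt, halted = False\<rparr>
              | Some p \<Rightarrow>
                  let \<mu> = momme_mu A b xt (iterate p) (gradient p)
                  in \<lparr>iterate = (1 - \<mu>) *\<^sub>R xt + \<mu> *\<^sub>R iterate p,
                      gradient = (1 - \<mu>) *\<^sub>R grad_quad A b xt + \<mu> *\<^sub>R gradient p,
                      halted = False\<rparr>)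
           else \<lparr>iterate = xt, gradient = grad_quad A b xt, halted = True\<rparr>
      else s)"

fun momme ::
    "real^'n^'n \<Rightarrow> real^'n \<Rightarrow> real \<Rightarrow> real^'n \<Rightarrow> nat \<Rightarrow> (real^'n) momme_state" where
  "momme A b c x0 0 = \<lparr>iterate = x0, gradient = grad_quad A b x0, halted = False\<rparr>"
| "momme A b c x0 (Suc 0) = momme_step A b c None (momme A b c x0 0)"
| "momme A b c x0 (Suc (Suc k)) =
     momme_step A b c (Some (momme A b c x0 k)) (momme A b c x0 (Suc k))"

definition momme_seq ::
    "real^'n^'n \<Rightarrow> real^'n \<Rightarrow> real \<Rightarrow> real^'n \<Rightarrow> nat \<Rightarrow> real^'n" where
  "momme_seq A b c x0 k = iterate (momme A b c x0 k)"

text \<open>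
  Since division by 0 and \<open>arg_min\<close> are total in HOL, \<open>momme\<close> is always defined. That the method
  really generates a sequence means that in every iteration that is performed the denominators
  are nonzero and the minimizer over the plane exists and is unique.
\<close>
definition momme_well_defined :: "real^'n^'n \<Rightarrow> real^'n \<Rightarrow> real \<Rightarrow> real^'n \<Rightarrow> bool" where
  "momme_well_defined A b c x0 \<longleftrightarrow>
     (\<forall>k. let s = momme A b c x0 k; x = iterate s; g = gradient s in
        running s \<longrightarrow>
          g \<bullet> (A *v g) \<noteq> 0 \<and>
          (lin_indep_pair g (momme_r A g) \<longrightarrow>
             (\<exists>!p. is_arg_min (plane_obj A b c x g) (\<lambda>_. True) p) \<and>
             (k \<ge> 1 \<longrightarrow>
                (let p = momme A b c x0 (k - 1)
                 in momme_den A b (momme_tilde A b c x g) (iterate p) (gradient p) \<noteq> 0))))"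

end

theory Submission
  imports Defs
begin

text \<open>
  Let \<open>e\<close> be the error of the current iterate, so that the gradient is \<open>g = A e\<close> and
  \<open>f x - f x\<^sub>* = (e \<bullet> A e) / 2\<close>. As \<open>r\<close> is \<open>g\<close> minus a nonzero multiple of \<open>A g\<close>, the plane of
  a step is \<open>x + span {A e, A (A e)}\<close>, and the errors of its points are the vectors \<open>p(A) e\<close> with a
  polynomial \<open>p\<close> of degree at most 2 and \<open>p(0) = 1\<close>. The minimizer over the plane is therefore at
  least as good as the choice of \<open>p\<close> as the normalized Chebyshev polynomial of degree 2 on the
  interval from the least eigenvalue \<open>m\<close> to the greatest eigenvalue \<open>M\<close>. This polynomial is bounded
  on the interval by \<open>(M - m)\<^sup>2 / (M\<^sup>2 + 6 M m + m\<^sup>2)\<close>, whose square is the claimed bound; it serves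
  as the rate \<open>\<eta>\<close> (\<open>plane_min_contracts\<close>). The momentum step is an exact
  line search through the tentative point, so it can only decrease \<open>f\<close> further
  (\<open>momentum_decreases\<close>). If \<open>g\<close> and \<open>r\<close> are linearly dependent, then \<open>g\<close> is an eigenvector and
  the half step lands on the minimizer itself (\<open>dependent_step_exact\<close>).

  The passage from the polynomial to the operator does not go through a diagonalization of \<open>A\<close>: what
  has to be shown is that \<open>A (M - A) (A - m)\<close> is positive semidefinite, and this follows from the
  quadratic form bounds \<open>m |v|\<^sup>2 \<le> v \<bullet> A v \<le> M |v|\<^sup>2\<close> (\<open>chebyshev2_contracts\<close>). The extreme values of
  the Rayleigh quotient are attained by compactness, and they are eigenvalues
  (\<open>ex_min_eigenvector\<close>).

  The denominator of \<open>\<mu>\<close> is positive because \<open>f\<close> strictly decreases as long as the gradient is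
  nonzero, so that a tentative point never returns to the iterate before the current one.
\<close>

section \<open>Quadratic forms of self-adjoint operators\<close>

text \<open>
  In operator terms, \<open>0 \<le> P \<le> D\<close> implies \<open>P\<^sup>2 \<le> D P\<close>. The reason is that the form of \<open>P\<close> is
  nonnegative at \<open>w - P w / D\<close>. The case \<open>D = 0\<close> is included: there it says that a vanishing form
  belongs to the zero operator.
\<close>
lemma psd_bounded_square_le:
  fixes P :: "'a::real_inner \<Rightarrow> 'a"
  assumes lin: "linear P" and sa: "\<And>u v. P u \<bullet> v = u \<bullet> P v"
    and lb: "\<And>v. 0 \<le> v \<bullet> P v" and ub: "\<And>v. v \<bullet> P v \<le> D * (v \<bullet> v)" and D: "0 \<le> D"
  shows "P w \<bullet> P w \<le> D * (w \<bullet> P w)"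
proof -
  have key: "0 \<le> w \<bullet> P w - 2 * s * (P w \<bullet> P w) + s\<^sup>2 * (D * (P w \<bullet> P w))" for s :: real
  proof -
    have "0 \<le> (w - s *\<^sub>R P w) \<bullet> P (w - s *\<^sub>R P w)" by (rule lb)
    also have "\<dots> = w \<bullet> P w - 2 * s * (P w \<bullet> P w) + s\<^sup>2 * (P w \<bullet> P (P w))"
      using sa[of w "P w"]
      by (simp add: linear_diff[OF lin] linear_scale[OF lin] inner_diff_left inner_diff_right
          power2_eq_square algebra_simps)
    also have "\<dots> \<le> w \<bullet> P w - 2 * s * (P w \<bullet> P w) + s\<^sup>2 * (D * (P w \<bullet> P w))"
      using mult_left_mono[OF ub[of "P w"], of "s\<^sup>2"] by simp
    finally show ?thesis .
  qed
  show ?thesis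
  proof (cases "D = 0")
    case True
    then have "w \<bullet> P w \<le> 0" using ub[of w] by simp
    then show ?thesis using key[of 1] True by simp
  next
    case False
    then have "0 \<le> w \<bullet> P w - (P w \<bullet> P w) / D"
      using key[of "1 / D"] by (simp add: power2_eq_square)
    then show ?thesis using False D by (simp add: field_simps)
  qed
qed

text \<open>
  A minimizer \<open>u\<close> of the quadratic form on the unit sphere is an eigenvector: with the minimum \<open>l\<close>,
  the operator \<open>f - l\<close> is positive semidefinite and its form vanishes at \<open>u\<close>.
\<close>
lemma ex_min_eigenvector:
  fixes f :: "'a::euclidean_space \<Rightarrow> 'a"
  assumes lin: "linear f" and sa: "\<And>u v. f u \<bullet> v = u \<bullet> f v"
  shows "\<exists>l u. u \<noteq> 0 \<and> f u = l *\<^sub>R u \<and> (\<forall>v. l * (v \<bullet> v) \<le> v \<bullet> f v)"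
proof -
  let ?S = "sphere (0::'a) 1"
  have cont: "continuous_on ?S (\<lambda>v. v \<bullet> f v)"
    by (intro continuous_intros linear_continuous_on linear_conv_bounded_linear[THEN iffD1] lin)
  have ne: "?S \<noteq> {}" by simp
  obtain u where u: "u \<in> ?S" "\<And>v. v \<in> ?S \<Longrightarrow> u \<bullet> f u \<le> v \<bullet> f v"
    using continuous_attains_inf[OF compact_sphere ne cont] by blast
  obtain z where z: "\<And>v. v \<in> ?S \<Longrightarrow> v \<bullet> f v \<le> z \<bullet> f z"
    using continuous_attains_sup[OF compact_sphere ne cont] by blast
  define l L where "l = u \<bullet> f u" and "L = z \<bullet> f z"
  have scaled: "\<exists>s. s \<in> ?S \<and> v \<bullet> f v = (s \<bullet> f s) * (v \<bullet> v)" for v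
  proof (cases "v = 0")
    case True
    then show ?thesis using u(1) by (intro exI[of _ u]) simp
  next
    case False
    let ?s = "v /\<^sub>R norm v"
    have "?s \<in> ?S" using False by simp
    moreover have "v \<bullet> f v = (?s \<bullet> f ?s) * (v \<bullet> v)"
      using False by (simp add: linear_scale[OF lin] dot_square_norm field_simps power2_eq_square)
    ultimately show ?thesis by blast
  qed
  have lower: "l * (v \<bullet> v) \<le> v \<bullet> f v" for v
    using scaled[of v] u(2) unfolding l_def by (metis inner_ge_zero mult_right_mono)
  have upper: "v \<bullet> f v \<le> L * (v \<bullet> v)" for v
    using scaled[of v] z unfolding L_def by (metis inner_ge_zero mult_right_mono)
  have unit: "u \<bullet> u = 1" using u(1) by (simp add: dot_square_norm)
  let ?P = "\<lambda>v. f v - l *\<^sub>R v"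
  have "?P u \<bullet> ?P u \<le> (L - l) * (u \<bullet> ?P u)"
  proof (rule psd_bounded_square_le)
    show "linear ?P"
      by (intro linear_compose_sub lin linear_scale_self)
    show "?P x \<bullet> y = x \<bullet> ?P y" for x y
      by (simp add: inner_diff_left inner_diff_right sa)
    show "0 \<le> v \<bullet> ?P v" for v
      using lower[of v] by (simp add: inner_diff_right)
    show "v \<bullet> ?P v \<le> (L - l) * (v \<bullet> v)" for v
      using upper[of v] by (simp add: inner_diff_right algebra_simps)
    show "0 \<le> L - l"
      using z[OF u(1)] by (simp add: l_def L_def)
  qed
  moreover have "u \<bullet> ?P u = 0"
    using unit by (simp add: inner_diff_right l_def)
  ultimately have "?P u = 0" by (metis inner_gt_zero_iff mult_zero_right not_less)
  moreover have "u \<noteq> 0" using unit by auto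
  ultimately show ?thesis using lower by auto
qed

text \<open>
  The coefficients of \<open>f e\<close> and \<open>f (f e)\<close> are those of the Chebyshev polynomial
  \<open>p(t) = (2 (2 t - M - m)\<^sup>2 - (M - m)\<^sup>2) / (M\<^sup>2 + 6 M m + m\<^sup>2)\<close>. In terms of \<open>B = f - (M + m) / 2\<close>
  and \<open>D = M - m\<close> the numerator is \<open>8 B\<^sup>2 - D\<^sup>2\<close>, and \<open>D\<^sup>4 - (8 B\<^sup>2 - D\<^sup>2)\<^sup>2 = 16 B\<^sup>2 (D\<^sup>2 - 4 B\<^sup>2)\<close> with
  \<open>D\<^sup>2 - 4 B\<^sup>2 = 4 (M - f) (f - m)\<close>. So the claim is that \<open>f (M - f) (f - m)\<close> has a nonnegative form
  at \<open>w = B e\<close>. This operator is \<open>(M - f) (f - m)\<^sup>2 + m (M - f) (f - m)\<close>, and both summands are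
  positive semidefinite, the second one by the inequality \<open>P\<^sup>2 \<le> D P\<close> for \<open>P = f - m\<close>.
\<close>
lemma chebyshev2_contracts:
  fixes f :: "'a::real_inner \<Rightarrow> 'a" and e :: 'a
  assumes lin: "linear f" and sa: "\<And>u v. f u \<bullet> v = u \<bullet> f v"
    and lb: "\<And>v. m * (v \<bullet> v) \<le> v \<bullet> f v" and ub: "\<And>v. v \<bullet> f v \<le> M * (v \<bullet> v)"
    and m: "0 < m" and mM: "m \<le> M"
  defines "N \<equiv> M\<^sup>2 + 6 * M * m + m\<^sup>2"
  defines "z \<equiv> e - (8 * (M + m) / N) *\<^sub>R f e + (8 / N) *\<^sub>R f (f e)"
  shows "z \<bullet> f z \<le> ((M - m)\<^sup>2 / N)\<^sup>2 * (e \<bullet> f e)"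
proof -
  note [simp] = linear_diff[OF lin] linear_add[OF lin] linear_scale[OF lin]
    inner_diff_left inner_diff_right inner_add_left inner_add_right
  have N: "0 < N" unfolding N_def using m mM by (simp add: add_pos_nonneg add_nonneg_pos)
  define B where "B = (\<lambda>v. f v - ((M + m) / 2) *\<^sub>R v)"
  define w where "w = B e"
  have saB: "B u \<bullet> v = u \<bullet> B v" for u v by (simp add: B_def sa)
  have comm: "B (f v) = f (B v)" for v by (simp add: B_def)
  have cubic: "4 * (B w \<bullet> f (B w)) \<le> (M - m)\<^sup>2 * (w \<bullet> f w)"
  proof -
    let ?P = "\<lambda>v. f v - m *\<^sub>R v"
    have "?P w \<bullet> ?P w \<le> (M - m) * (w \<bullet> ?P w)"
    proof (rule psd_bounded_square_le)
      show "linear ?P" by (intro linear_compose_sub lin linear_scale_self)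
      show "?P x \<bullet> y = x \<bullet> ?P y" for x y by (simp add: sa)
      show "0 \<le> v \<bullet> ?P v" for v using lb[of v] by simp
      show "v \<bullet> ?P v \<le> (M - m) * (v \<bullet> v)" for v
        using ub[of v] by (simp add: left_diff_distrib)
      show "0 \<le> M - m" using mM by simp
    qed
    then have 1: "0 \<le> m * ((M - m) * (w \<bullet> ?P w) - ?P w \<bullet> ?P w)"
      using m by simp
    have 2: "0 \<le> M * (?P w \<bullet> ?P w) - ?P w \<bullet> f (?P w)"
      using ub[of "?P w"] by simp
    have swap: "f w \<bullet> w = w \<bullet> f w" "f (f w) \<bullet> w = f w \<bullet> f w" "w \<bullet> f (f w) = f w \<bullet> f w"
        "f (f w) \<bullet> f w = f w \<bullet> f (f w)"
      by (simp_all add: sa inner_commute)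
    have eq: "(M - m)\<^sup>2 * (w \<bullet> f w) - 4 * (B w \<bullet> f (B w))
        = 4 * (m * ((M - m) * (w \<bullet> ?P w) - ?P w \<bullet> ?P w) + (M * (?P w \<bullet> ?P w) - ?P w \<bullet> f (?P w)))"
      unfolding B_def
      by (simp add: swap) (simp add: field_simps power2_eq_square)
    have "0 \<le> (M - m)\<^sup>2 * (w \<bullet> f w) - 4 * (B w \<bullet> f (B w))"
      unfolding eq by (rule mult_nonneg_nonneg[OF zero_le_numeral add_nonneg_nonneg[OF 1 2]])
    then show ?thesis by (simp only: diff_ge_0_iff_ge)
  qed
  have z: "z = (1 / N) *\<^sub>R (8 *\<^sub>R B w - (M - m)\<^sup>2 *\<^sub>R e)"
  proof -
    have "N *\<^sub>R z = N *\<^sub>R e - (8 * (M + m)) *\<^sub>R f e + 8 *\<^sub>R f (f e)"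
      using N by (simp add: z_def scaleR_right_diff_distrib scaleR_add_right)
    also have "\<dots> = 8 *\<^sub>R B w - (M - m)\<^sup>2 *\<^sub>R e"
    proof -
      define k where "k = (M + m) / 2"
      have "8 *\<^sub>R B w = 8 *\<^sub>R f (f e) - (8 * k + 8 * k) *\<^sub>R f e + (8 * (k * k)) *\<^sub>R e"
        using scaleR_left_distrib[of "8 * k" "8 * k" "f e"]
        by (simp add: w_def B_def scaleR_right_diff_distrib flip: k_def)
      moreover have "8 * k + 8 * k = 8 * (M + m)" "8 * (k * k) = 2 * (M + m)\<^sup>2"
        by (simp_all add: k_def power2_eq_square)
      moreover have "N = 2 * (M + m)\<^sup>2 - (M - m)\<^sup>2"
        by (simp add: N_def power2_eq_square algebra_simps)
      ultimately show ?thesis by (simp only: scaleR_left_diff_distrib) simp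
    qed
    finally show ?thesis using N by (simp add: vector_fraction_eq_iff eq_vector_fraction_iff)
  qed
  have "f e \<bullet> B w = w \<bullet> f w" "B w \<bullet> f e = w \<bullet> f w" "e \<bullet> f (B w) = w \<bullet> f w"
    using saB[of "f e" w] comm[of e] sa[of e "B w"] by (simp_all add: w_def inner_commute sa)
  then have "(8 *\<^sub>R B w - (M - m)\<^sup>2 *\<^sub>R e) \<bullet> f (8 *\<^sub>R B w - (M - m)\<^sup>2 *\<^sub>R e)
      = 64 * (B w \<bullet> f (B w)) - 16 * (M - m)\<^sup>2 * (w \<bullet> f w) + ((M - m)\<^sup>2)\<^sup>2 * (e \<bullet> f e)"
    unfolding power2_eq_square[of "(M - m)\<^sup>2"]
    by (simp add: right_diff_distrib flip: power_add)
  moreover have "((1 / N) *\<^sub>R v) \<bullet> f ((1 / N) *\<^sub>R v) = (v \<bullet> f v) / N\<^sup>2" for v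
    by (simp add: power2_eq_square)
  ultimately have "z \<bullet> f z
      = (64 * (B w \<bullet> f (B w)) - 16 * (M - m)\<^sup>2 * (w \<bullet> f w) + ((M - m)\<^sup>2)\<^sup>2 * (e \<bullet> f e)) / N\<^sup>2"
    unfolding z by (simp only:)
  also have "\<dots> \<le> (((M - m)\<^sup>2)\<^sup>2 * (e \<bullet> f e)) / N\<^sup>2"
    using cubic by (intro divide_right_mono) (auto simp: mult_ac)
  finally show ?thesis by (simp add: power_divide)
qed

section \<open>Extreme eigenvalues of a symmetric matrix\<close>

lemma symmetric_matrix_self_adjoint:
  fixes A :: "real^'n^'n"
  assumes "transpose A = A"
  shows "(A *v u) \<bullet> v = u \<bullet> (A *v v)"
  using assms by (metis dot_lmul_matrix transpose_matrix_vector)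

text \<open>Eigenvectors of distinct eigenvalues are orthogonal, hence linearly independent.\<close>
lemma finite_eigenvalues:
  fixes A :: "real^'n^'n"
  assumes "transpose A = A"
  shows "finite (eigenvalues A)"
proof -
  have "\<forall>l\<in>eigenvalues A. \<exists>v. v \<noteq> 0 \<and> A *v v = l *\<^sub>R v"
    by (simp add: eigenvalues_def)
  then obtain v where v: "\<And>l. l \<in> eigenvalues A \<Longrightarrow> v l \<noteq> 0 \<and> A *v v l = l *\<^sub>R v l"
    by metis
  have orth: "v k \<bullet> v l = 0" if "k \<in> eigenvalues A" "l \<in> eigenvalues A" "k \<noteq> l" for k l
  proof -
    have "k * (v k \<bullet> v l) = l * (v k \<bullet> v l)"
      using symmetric_matrix_self_adjoint[OF assms, of "v k" "v l"] v that by simp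
    then show ?thesis using that(3) by simp
  qed
  have "inj_on v (eigenvalues A)"
    using orth v by (metis inj_onI inner_eq_zero_iff)
  moreover have "independent (v ` eigenvalues A)"
    using orth v by (intro pairwise_orthogonal_independent) (auto simp: pairwise_def orthogonal_def)
  ultimately show ?thesis
    using finite_imageD independent_imp_finite by blast
qed

lemma symmetric_Min_eigenvalue:
  fixes A :: "real^'n^'n"
  assumes "transpose A = A"
  shows "Min (eigenvalues A) \<in> eigenvalues A"
    and "Min (eigenvalues A) * (v \<bullet> v) \<le> v \<bullet> (A *v v)"
proof -
  obtain l u where u: "u \<noteq> 0" "A *v u = l *\<^sub>R u" and l: "\<And>v. l * (v \<bullet> v) \<le> v \<bullet> (A *v v)"
    using ex_min_eigenvector[of "(*v) A"] symmetric_matrix_self_adjoint[OF assms]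
    by (metis matrix_vector_mul_linear)
  have mem: "l \<in> eigenvalues A" using u by (auto simp: eigenvalues_def)
  have "l \<le> k" if k: "k \<in> eigenvalues A" for k
  proof -
    obtain y where "y \<noteq> 0" "A *v y = k *\<^sub>R y" using k by (auto simp: eigenvalues_def)
    then show ?thesis using l[of y] by simp
  qed
  then have "Min (eigenvalues A) = l"
    using mem finite_eigenvalues[OF assms] by (intro Min_eqI) auto
  then show "Min (eigenvalues A) \<in> eigenvalues A"
    and "Min (eigenvalues A) * (v \<bullet> v) \<le> v \<bullet> (A *v v)"
    using mem l by simp_all
qed

lemma symmetric_le_Max_eigenvalue:
  fixes A :: "real^'n^'n"
  assumes "transpose A = A"
  shows "v \<bullet> (A *v v) \<le> Max (eigenvalues A) * (v \<bullet> v)"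
proof -
  have "linear (\<lambda>v. - (A *v v))" by (simp add: linear_compose_neg)
  moreover have "- (A *v u) \<bullet> w = u \<bullet> - (A *v w)" for u w
    by (simp add: symmetric_matrix_self_adjoint[OF assms])
  ultimately obtain l u where u: "u \<noteq> 0" "- (A *v u) = l *\<^sub>R u"
    and l: "\<And>v. l * (v \<bullet> v) \<le> v \<bullet> - (A *v v)"
    using ex_min_eigenvector[of "\<lambda>v. - (A *v v)"] by blast
  have "A *v u = (- l) *\<^sub>R u" using u(2) by (metis scaleR_minus_left minus_minus)
  then have "- l \<in> eigenvalues A" using u(1) unfolding eigenvalues_def by blast
  then have "- l \<le> Max (eigenvalues A)" by (simp add: finite_eigenvalues[OF assms])
  then have "- l * (v \<bullet> v) \<le> Max (eigenvalues A) * (v \<bullet> v)"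
    by (rule mult_right_mono[OF _ inner_ge_zero])
  with l[of v] show ?thesis by simp
qed

section \<open>Quadratic objectives and the search plane\<close>

lemma quad_expand:
  assumes "transpose A = A"
  shows "quad A b c (z + d) = quad A b c z + grad_quad A b z \<bullet> d + 1/2 * (d \<bullet> (A *v d))"
  using symmetric_matrix_self_adjoint[OF assms, of z d]
  by (simp add: quad_def grad_quad_def matrix_vector_right_distrib inner_add_left inner_add_right
      inner_diff_left inner_commute algebra_simps)

lemma spd_pos: "sym_pos_def A \<Longrightarrow> v \<noteq> 0 \<Longrightarrow> 0 < v \<bullet> (A *v v)"
  and spd_sym: "sym_pos_def A \<Longrightarrow> transpose A = A"
  by (auto simp: sym_pos_def_def)

lemma spd_nonneg: "sym_pos_def A \<Longrightarrow> 0 \<le> v \<bullet> (A *v v)"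
  by (cases "v = 0") (auto intro: less_imp_le spd_pos)

lemma spd_surj:
  fixes A :: "real^'n^'n"
  assumes "sym_pos_def A"
  shows "\<exists>x. A *v x = b"
proof -
  have "v = 0" if "A *v v = 0" for v
    using spd_pos[OF assms, of v] that by force
  then have "inj ((*v) A)" by (simp add: linear_injective_0)
  then have "surj ((*v) A)" by (simp add: linear_injective_imp_surjective)
  then show ?thesis by (metis surjD)
qed

lemma lin_indep_pair_combination_nonzero:
  assumes "lin_indep_pair u v" and "p \<noteq> 0 \<or> q \<noteq> 0"
  shows "p *\<^sub>R u + q *\<^sub>R v \<noteq> 0"
proof
  assume zero: "p *\<^sub>R u + q *\<^sub>R v = 0"
  have ind: "independent {u, v}" and ne: "u \<noteq> v" using assms(1) by (auto simp: lin_indep_pair_def)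
  have "(\<Sum>x\<in>{u, v}. (if x = u then p else q) *\<^sub>R x) = 0" using zero ne by simp
  from independentD[OF ind _ order_refl this] ne assms(2) show False by fastforce
qed

lemma not_lin_indep_pairD:
  assumes "\<not> lin_indep_pair u v" and "u \<noteq> 0"
  shows "\<exists>q. v = q *\<^sub>R u"
proof (cases "u = v")
  case True
  then show ?thesis by (metis scaleR_one)
next
  case False
  then have "dependent (insert v {u})"
    using assms(1) by (simp add: lin_indep_pair_def insert_commute)
  then have "v \<in> span {u}"
    using assms(2) independent_insert[of v "{u}"] by (auto split: if_splits)
  then show ?thesis by (auto simp: span_singleton)
qed

text \<open>
  The normal equations say that the gradient at the minimizer is orthogonal to \<open>g\<close> and \<open>r\<close>. Their
  determinant \<open>a d - h\<^sup>2\<close> is positive because \<open>a (a d - h\<^sup>2)\<close> is the form of \<open>A\<close> at \<open>a r - h g\<close>, which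
  is nonzero by linear independence; the solution is given by Cramer's rule.
\<close>
lemma ex1_plane_min:
  assumes spd: "sym_pos_def A" and ind: "lin_indep_pair g (momme_r A g)"
  shows "\<exists>!p. is_arg_min (plane_obj A b c x g) (\<lambda>_. True) p"
proof -
  define r where "r = momme_r A g"
  note ind = ind[folded r_def]
  note sym = spd_sym[OF spd]
  define a h d where "a = g \<bullet> (A *v g)" and "h = g \<bullet> (A *v r)" and "d = r \<bullet> (A *v r)"
  have g: "g \<noteq> 0" using lin_indep_pair_combination_nonzero[OF ind, of 1 0] by simp
  have a: "0 < a" unfolding a_def by (rule spd_pos[OF spd g])
  have h': "r \<bullet> (A *v g) = h"
    using symmetric_matrix_self_adjoint[OF sym, of r g] by (simp add: h_def inner_commute)
  have "0 < ((- h) *\<^sub>R g + a *\<^sub>R r) \<bullet> (A *v ((- h) *\<^sub>R g + a *\<^sub>R r))"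
    using a by (intro spd_pos[OF spd] lin_indep_pair_combination_nonzero[OF ind]) simp
  also have "\<dots> = a * (a * d - h\<^sup>2)"
    by (simp add: matrix_vector_right_distrib matrix_vector_mult_scaleR inner_add_left
        matrix_vector_mult_diff_distrib
        inner_diff_left inner_diff_right inner_add_right h' flip: a_def h_def d_def)
      (simp add: power2_eq_square algebra_simps)
  finally have det: "0 < a * d - h\<^sup>2" using a by (simp add: zero_less_mult_iff)
  define G where "G = grad_quad A b x"
  define \<alpha> \<beta> where "\<alpha> = (h * (G \<bullet> r) - d * (G \<bullet> g)) / (a * d - h\<^sup>2)"
    and "\<beta> = (h * (G \<bullet> g) - a * (G \<bullet> r)) / (a * d - h\<^sup>2)"
  define y where "y = x + \<alpha> *\<^sub>R g + \<beta> *\<^sub>R r"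
  have grad: "grad_quad A b y = G + \<alpha> *\<^sub>R (A *v g) + \<beta> *\<^sub>R (A *v r)"
    by (simp add: y_def G_def grad_quad_def matrix_vector_right_distrib matrix_vector_mult_scaleR)
  have swap: "(A *v g) \<bullet> g = a" "(A *v r) \<bullet> g = h" "(A *v g) \<bullet> r = h" "(A *v r) \<bullet> r = d"
    using h' by (simp_all add: a_def h_def d_def inner_commute)
  have "grad_quad A b y \<bullet> g = G \<bullet> g + \<alpha> * a + \<beta> * h"
    by (simp add: grad inner_add_left swap)
  also have "\<dots> = 0"
    using det by (simp add: \<alpha>_def \<beta>_def field_simps power2_eq_square)
  finally have og: "grad_quad A b y \<bullet> g = 0" .
  have "grad_quad A b y \<bullet> r = G \<bullet> r + \<alpha> * h + \<beta> * d"
    by (simp add: grad inner_add_left swap)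
  also have "\<dots> = 0"
    using det by (simp add: \<alpha>_def \<beta>_def field_simps power2_eq_square)
  finally have or: "grad_quad A b y \<bullet> r = 0" .
  define dir where "dir = (\<lambda>(p, q). (p - \<alpha>) *\<^sub>R g + (q - \<beta>) *\<^sub>R r)"
  have val: "plane_obj A b c x g p = quad A b c y + 1/2 * (dir p \<bullet> (A *v dir p))" for p
  proof -
    have "plane_obj A b c x g p = quad A b c (y + dir p)"
      by (cases p) (simp add: plane_obj_def y_def dir_def scaleR_left_diff_distrib add.assoc flip: r_def)
    moreover have "grad_quad A b y \<bullet> dir p = 0"
      using og or by (cases p) (simp add: dir_def inner_add_right)
    ultimately show ?thesis by (simp add: quad_expand[OF sym])
  qed
  have dir0: "dir (\<alpha>, \<beta>) = 0" by (simp add: dir_def)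
  have dir_nz: "dir p \<noteq> 0" if "p \<noteq> (\<alpha>, \<beta>)" for p
  proof -
    obtain p1 p2 where p: "p = (p1, p2)" by (cases p)
    then have "p1 - \<alpha> \<noteq> 0 \<or> p2 - \<beta> \<noteq> 0" using that by simp
    then show ?thesis
      unfolding p dir_def prod.case by (rule lin_indep_pair_combination_nonzero[OF ind])
  qed
  show ?thesis
  proof (rule ex1I)
    show "is_arg_min (plane_obj A b c x g) (\<lambda>_. True) (\<alpha>, \<beta>)"
      by (auto simp: is_arg_min_linorder val dir0 spd_nonneg[OF spd])
  next
    fix p
    assume "is_arg_min (plane_obj A b c x g) (\<lambda>_. True) p"
    then have "plane_obj A b c x g p \<le> plane_obj A b c x g (\<alpha>, \<beta>)"
      by (simp add: is_arg_min_linorder)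
    then have "dir p \<bullet> (A *v dir p) \<le> 0" by (simp add: val dir0)
    then show "p = (\<alpha>, \<beta>)" using spd_pos[OF spd dir_nz[of p]] by fastforce
  qed
qed

lemma momme_tilde_optimal:
  assumes spd: "sym_pos_def A" and ind: "lin_indep_pair g (momme_r A g)"
  shows "quad A b c (momme_tilde A b c x g) \<le> quad A b c (x + p *\<^sub>R g + q *\<^sub>R momme_r A g)"
proof -
  let ?F = "plane_obj A b c x g"
  have "is_arg_min ?F (\<lambda>_. True) (arg_min ?F (\<lambda>_. True))"
    unfolding arg_min_def using ex1_plane_min[OF spd ind] by (metis someI_ex)
  then have "?F (arg_min ?F (\<lambda>_. True)) \<le> ?F (p, q)"
    by (simp add: is_arg_min_linorder)
  moreover have "quad A b c (momme_tilde A b c x g) = ?F (arg_min ?F (\<lambda>_. True))"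
    using ind by (simp add: momme_tilde_def plane_obj_def split: prod.split)
  ultimately show ?thesis by (simp add: plane_obj_def)
qed

section \<open>A single iteration\<close>

text \<open>
  The square of the maximum that the normalized Chebyshev polynomial of degree 2 attains in absolute
  value on the interval between the extreme eigenvalues. It bounds the factor by which one iteration
  shrinks \<open>f x - f x\<^sub>*\<close>.
\<close>
definition momme_rate :: "real^'n^'n \<Rightarrow> real" where
  "momme_rate A = (cond_number A - 1)^4 / ((cond_number A)\<^sup>2 + 6 * cond_number A + 1)\<^sup>2"

lemma spd_Min_eigenvalue_pos:
  assumes "sym_pos_def A"
  shows "0 < Min (eigenvalues A)"
proof -
  obtain v where v: "v \<noteq> 0" "A *v v = Min (eigenvalues A) *\<^sub>R v"
    using symmetric_Min_eigenvalue(1)[OF spd_sym[OF assms]] by (auto simp: eigenvalues_def)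
  then have "0 < Min (eigenvalues A) * (v \<bullet> v)"
    using spd_pos[OF assms v(1)] by simp
  then show ?thesis by (metis inner_ge_zero mult_nonpos_nonneg not_less)
qed

lemma spd_Min_le_Max_eigenvalue:
  assumes "sym_pos_def A"
  shows "Min (eigenvalues A) \<le> Max (eigenvalues A)"
  using symmetric_Min_eigenvalue(1)[OF spd_sym[OF assms]] finite_eigenvalues[OF spd_sym[OF assms]]
  by simp

lemma momme_rate_eigenvalues:
  fixes A :: "real^'n^'n"
  assumes "sym_pos_def A"
  defines "m \<equiv> Min (eigenvalues A)" and "M \<equiv> Max (eigenvalues A)"
  shows "momme_rate A = ((M - m)\<^sup>2 / (M\<^sup>2 + 6 * M * m + m\<^sup>2))\<^sup>2"
proof -
  have m: "0 < m" unfolding m_def by (rule spd_Min_eigenvalue_pos[OF assms(1)])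
  have "M / m - 1 = (M - m) / m" "(M / m)\<^sup>2 + 6 * (M / m) + 1 = (M\<^sup>2 + 6 * M * m + m\<^sup>2) / m\<^sup>2"
    using m by (simp_all add: field_simps power2_eq_square)
  then have "momme_rate A = ((M - m) / m)^4 / ((M\<^sup>2 + 6 * M * m + m\<^sup>2) / m\<^sup>2)\<^sup>2"
    by (simp add: momme_rate_def cond_number_def flip: m_def M_def)
  then show ?thesis using m by (simp add: power_divide flip: power_mult)
qed

lemma momme_rate_nonneg: "0 \<le> momme_rate A"
  by (simp add: momme_rate_def)

lemma momme_rate_less_1:
  assumes "sym_pos_def A"
  shows "momme_rate A < 1"
proof -
  let ?m = "Min (eigenvalues A)" and ?M = "Max (eigenvalues A)"
  have "0 < ?M * ?m" "0 < ?m"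
    using spd_Min_eigenvalue_pos[OF assms] spd_Min_le_Max_eigenvalue[OF assms] by simp_all
  moreover from this have "0 < ?M\<^sup>2 + 6 * ?M * ?m + ?m\<^sup>2"
    by (metis add_pos_nonneg add_nonneg_pos mult.assoc mult_pos_pos zero_le_power2 zero_less_numeral)
  ultimately have "(?M - ?m)\<^sup>2 / (?M\<^sup>2 + 6 * ?M * ?m + ?m\<^sup>2) < 1"
    and "0 \<le> (?M - ?m)\<^sup>2 / (?M\<^sup>2 + 6 * ?M * ?m + ?m\<^sup>2)"
    by (simp add: power2_diff, intro divide_nonneg_pos) simp_all
  then show ?thesis
    unfolding momme_rate_eigenvalues[OF assms] by (simp only: abs_square_less_1 abs_of_nonneg)
qed

lemma quad_minus_min:
  assumes "transpose A = A" and "A *v xs = b"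
  shows "quad A b c x - quad A b c xs = 1/2 * ((x - xs) \<bullet> (A *v (x - xs)))"
  using quad_expand[OF assms(1), of b c xs "x - xs"] assms(2) by (simp add: grad_quad_def)

text \<open>
  Since \<open>r = g - t A g\<close> with \<open>t \<noteq> 0\<close>, the plane contains the point whose error is the Chebyshev
  polynomial of \<open>A\<close> applied to the current error.
\<close>
lemma plane_min_contracts:
  fixes A :: "real^'n^'n"
  assumes spd: "sym_pos_def A" and xs: "A *v xs = b" and g: "g = grad_quad A b x"
    and ind: "lin_indep_pair g (momme_r A g)"
  shows "quad A b c (momme_tilde A b c x g) - quad A b c xs
    \<le> momme_rate A * (quad A b c x - quad A b c xs)"
proof -
  note sym = spd_sym[OF spd]
  let ?m = "Min (eigenvalues A)" and ?M = "Max (eigenvalues A)"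
  define N where "N = ?M\<^sup>2 + 6 * ?M * ?m + ?m\<^sup>2"
  define e where "e = x - xs"
  have Ae: "A *v e = g"
    by (simp add: e_def g grad_quad_def matrix_vector_mult_diff_distrib xs)
  define z where "z = e - (8 * (?M + ?m) / N) *\<^sub>R (A *v e) + (8 / N) *\<^sub>R (A *v (A *v e))"
  have bound: "z \<bullet> (A *v z) \<le> momme_rate A * (e \<bullet> (A *v e))"
    unfolding z_def N_def momme_rate_eigenvalues[OF spd]
    by (rule chebyshev2_contracts)
      (simp_all add: symmetric_matrix_self_adjoint[OF sym] symmetric_Min_eigenvalue(2)[OF sym]
        symmetric_le_Max_eigenvalue[OF sym] spd_Min_eigenvalue_pos[OF spd]
        spd_Min_le_Max_eigenvalue[OF spd])
  define t where "t = momme_t A g"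
  have "g \<noteq> 0" using lin_indep_pair_combination_nonzero[OF ind, of 1 0] by simp
  then have t: "t \<noteq> 0" using spd_pos[OF spd, of g] by (simp add: t_def momme_t_def)
  \<comment> \<open>\<open>A g = (g - r) / t\<close> turns the coefficients of \<open>g\<close> and \<open>A g\<close> into those of \<open>g\<close> and \<open>r\<close>.\<close>
  have "x + (8 / N / t - 8 * (?M + ?m) / N) *\<^sub>R g + (- (8 / N / t)) *\<^sub>R momme_r A g = xs + z"
  proof -
    have "(8 / N / t) *\<^sub>R momme_r A g = (8 / N / t) *\<^sub>R g - (8 / N) *\<^sub>R (A *v g)"
      using t by (simp add: momme_r_def scaleR_right_diff_distrib flip: t_def)
    then show ?thesis
      by (simp add: z_def Ae scaleR_left_diff_distrib) (simp add: e_def)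
  qed
  then have "quad A b c (momme_tilde A b c x g) \<le> quad A b c (xs + z)"
    using momme_tilde_optimal[OF spd ind] by metis
  then have "quad A b c (momme_tilde A b c x g) - quad A b c xs \<le> 1/2 * (z \<bullet> (A *v z))"
    using quad_minus_min[OF sym xs, of c "xs + z"] by simp
  also have "\<dots> \<le> momme_rate A * (quad A b c x - quad A b c xs)"
    using bound by (simp add: quad_minus_min[OF sym xs] e_def)
  finally show ?thesis .
qed

text \<open>
  Linear dependence makes \<open>g\<close> an eigenvector, say for \<open>l\<close>. Then the error is \<open>g / l\<close>, while
  the half step is \<open>t / 2 = 1 / l\<close>, the exact line search along \<open>- g\<close>.
\<close>
lemma dependent_step_exact:
  fixes A :: "real^'n^'n"
  assumes spd: "sym_pos_def A" and xs: "A *v xs = b" and g: "g = grad_quad A b x"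
    and g0: "g \<noteq> 0" and dep: "\<not> lin_indep_pair g (momme_r A g)"
  shows "momme_tilde A b c x g = xs"
proof -
  define t where "t = momme_t A g"
  have pos: "0 < g \<bullet> (A *v g)" by (rule spd_pos[OF spd g0])
  then have t: "t \<noteq> 0" using g0 by (simp add: t_def momme_t_def)
  obtain q where "momme_r A g = q *\<^sub>R g" using not_lin_indep_pairD[OF dep g0] by blast
  then have "t *\<^sub>R (A *v g) = (1 - q) *\<^sub>R g"
    by (simp add: momme_r_def scaleR_left_diff_distrib algebra_simps flip: t_def)
  then have "(1 / t) *\<^sub>R (t *\<^sub>R (A *v g)) = (1 / t) *\<^sub>R ((1 - q) *\<^sub>R g)" by simp
  then obtain l where l: "A *v g = l *\<^sub>R g" using t by auto
  have l0: "l \<noteq> 0" using pos l by auto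
  have tl: "t = 2 / l"
    using g0 by (simp add: t_def momme_t_def l dot_square_norm)
  let ?e = "x - xs - (1 / l) *\<^sub>R g"
  have "A *v x - b = g" by (simp add: g grad_quad_def)
  then have "A *v ?e = 0"
    using l0 by (simp add: matrix_vector_mult_diff_distrib matrix_vector_mult_scaleR l xs)
  then have "?e = 0" using spd_pos[OF spd, of ?e] by force
  moreover have "momme_tilde A b c x g = x - (1 / l) *\<^sub>R g"
  proof -
    have "(1 / 2) *\<^sub>R (x + (x - (2 / l) *\<^sub>R g)) = ((1 / 2) *\<^sub>R x + (1 / 2) *\<^sub>R x) - (1 / l) *\<^sub>R g"
      by (simp add: scaleR_add_right scaleR_right_diff_distrib)
    then show ?thesis
      using dep tl by (simp add: momme_tilde_def momme_y_def flip: t_def scaleR_left_distrib)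
  qed
  ultimately show ?thesis by (simp add: algebra_simps)
qed

lemma momme_den_pos:
  assumes "sym_pos_def A" and "gp = grad_quad A b xp" and "xt \<noteq> xp"
  shows "0 < momme_den A b xt xp gp"
  using spd_pos[OF assms(1), of "xt - xp"] assms(2,3)
  by (simp add: momme_den_def grad_quad_def matrix_vector_mult_diff_distrib)

text \<open>The parameter \<open>\<mu>\<close> is the minimizer of \<open>f\<close> on the line through \<open>xt\<close> and \<open>xp\<close>.\<close>
lemma momentum_decreases:
  fixes A :: "real^'n^'n" and xt :: "real^'n"
  assumes spd: "sym_pos_def A" and gp: "gp = grad_quad A b xp"
  defines "\<mu> \<equiv> momme_mu A b xt xp gp"
  shows "quad A b c ((1 - \<mu>) *\<^sub>R xt + \<mu> *\<^sub>R xp) \<le> quad A b c xt"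
proof (cases "xt = xp")
  case True
  then show ?thesis by (simp add: scaleR_left_diff_distrib)
next
  case False
  define s where "s = xt - xp"
  define G S where "G = grad_quad A b xt \<bullet> s" and "S = s \<bullet> (A *v s)"
  have S: "0 < S" using False by (simp add: S_def s_def spd_pos[OF spd])
  have mu: "\<mu> = G / S"
    by (simp add: \<mu>_def momme_mu_def momme_den_def G_def S_def s_def gp grad_quad_def
        matrix_vector_mult_diff_distrib)
  have pt: "(1 - \<mu>) *\<^sub>R xt + \<mu> *\<^sub>R xp = xt + (- \<mu>) *\<^sub>R s"
    by (simp add: s_def algebra_simps)
  have "quad A b c (xt + (- \<mu>) *\<^sub>R s) = quad A b c xt - \<mu> * G + 1/2 * (\<mu>\<^sup>2 * S)"
    unfolding quad_expand[OF spd_sym[OF spd]]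
    by (simp add: G_def S_def matrix_vector_mult_scaleR power2_eq_square
        del: scaleR_minus_left flip: scaleR_minus_left)
  also have "\<dots> = quad A b c xt - 1/2 * (G\<^sup>2 / S)"
    using S by (simp add: mu power2_eq_square)
  also have "\<dots> \<le> quad A b c xt" using S by simp
  finally show ?thesis unfolding pt .
qed

section \<open>The iteration\<close>

text \<open>
  Updating the gradient by the same affine combination as the iterate keeps it the true gradient, and
  the method halts only at the minimizer, so a state that is not running has gradient zero.
\<close>
definition momme_sound :: "real^'n^'n \<Rightarrow> real^'n \<Rightarrow> (real^'n) momme_state \<Rightarrow> bool" where
  "momme_sound A b s \<longleftrightarrow>
     gradient s = grad_quad A b (iterate s) \<and> (halted s \<longrightarrow> gradient s = 0)"

lemma grad_quad_eq_0_iff: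
  assumes "sym_pos_def A" and "A *v xs = b"
  shows "grad_quad A b x = 0 \<longleftrightarrow> x = xs"
proof
  assume "grad_quad A b x = 0"
  then have "A *v (x - xs) = 0"
    using assms(2) by (simp add: grad_quad_def matrix_vector_mult_diff_distrib)
  then show "x = xs" using spd_pos[OF assms(1), of "x - xs"] by force
qed (simp add: grad_quad_def assms(2))

lemma momme_step_sound_contracts:
  fixes A :: "real^'n^'n" and c :: real
  assumes spd: "sym_pos_def A" and xs: "A *v xs = b" and s: "momme_sound A b s"
    and prev: "\<And>p. prev = Some p \<Longrightarrow> momme_sound A b p"
  defines "s' \<equiv> momme_step A b c prev s"
  shows "momme_sound A b s'"
    and "quad A b c (iterate s') - quad A b c xs
      \<le> momme_rate A * (quad A b c (iterate s) - quad A b c xs)"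
proof -
  let ?x = "iterate s" and ?g = "gradient s"
  let ?xt = "momme_tilde A b c ?x ?g"
  have g: "?g = grad_quad A b ?x" using s by (simp add: momme_sound_def)
  have nonneg: "0 \<le> momme_rate A * (quad A b c ?x - quad A b c xs)"
    by (simp add: quad_minus_min[OF spd_sym[OF spd] xs] momme_rate_nonneg spd_nonneg[OF spd])
  have "momme_sound A b s' \<and> quad A b c (iterate s') - quad A b c xs
      \<le> momme_rate A * (quad A b c ?x - quad A b c xs)"
  proof (cases "running s")
    case False
    then have "?g = 0" using s by (auto simp: running_def momme_sound_def)
    then have "?x = xs" using grad_quad_eq_0_iff[OF spd xs] g by simp
    then show ?thesis using False s by (simp add: s'_def momme_step_def)
  next
    case run: True
    then have g0: "?g \<noteq> 0" by (simp add: running_def)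
    show ?thesis
    proof (cases "lin_indep_pair ?g (momme_r A ?g)")
      case False
      have "?xt = xs" by (rule dependent_step_exact[OF spd xs g g0 False])
      then show ?thesis
        using run False nonneg
        by (simp add: s'_def momme_step_def momme_sound_def grad_quad_eq_0_iff[OF spd xs])
    next
      case True
      note contr = plane_min_contracts[OF spd xs g True, of c]
      show ?thesis
      proof (cases prev)
        case None
        then show ?thesis
          using run True contr by (simp add: s'_def momme_step_def momme_sound_def Let_def)
      next
        case (Some p)
        have gp: "gradient p = grad_quad A b (iterate p)"
          using prev[OF Some] by (simp add: momme_sound_def)
        define \<mu> where "\<mu> = momme_mu A b ?xt (iterate p) (gradient p)"
        have s': "s' = \<lparr>iterate = (1 - \<mu>) *\<^sub>R ?xt + \<mu> *\<^sub>R iterate p,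
            gradient = (1 - \<mu>) *\<^sub>R grad_quad A b ?xt + \<mu> *\<^sub>R gradient p, halted = False\<rparr>"
          using run True Some by (simp add: s'_def momme_step_def Let_def \<mu>_def)
        have "gradient s' = grad_quad A b (iterate s')"
          by (simp add: s' gp grad_quad_def matrix_vector_right_distrib matrix_vector_mult_scaleR
              matrix_vector_mult_diff_distrib algebra_simps)
        moreover have "quad A b c (iterate s') \<le> quad A b c ?xt"
          using momentum_decreases[OF spd gp, of c ?xt] by (simp add: s' \<mu>_def)
        ultimately show ?thesis using contr by (simp add: momme_sound_def s')
      qed
    qed
  qed
  then show "momme_sound A b s'"
    and "quad A b c (iterate s') - quad A b c xs
      \<le> momme_rate A * (quad A b c (iterate s) - quad A b c xs)"
    by auto
qed

lemma momme_states_sound: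
  assumes spd: "sym_pos_def A"
  shows "momme_sound A b (momme A b c x0 k)"
proof -
  obtain xs where xs: "A *v xs = b" using spd_surj[OF spd] by blast
  have "momme_sound A b (momme A b c x0 k) \<and> momme_sound A b (momme A b c x0 (Suc k))"
  proof (induction k)
    case 0
    have "momme_sound A b (momme A b c x0 0)" by (simp add: momme_sound_def)
    then show ?case using momme_step_sound_contracts(1)[OF spd xs, where prev = None] by simp
  next
    case (Suc k)
    then have "momme_sound A b (momme A b c x0 (Suc (Suc k)))"
      using momme_step_sound_contracts(1)[OF spd xs, where prev = "Some (momme A b c x0 k)"] by simp
    then show ?case using Suc by blast
  qed
  then show ?thesis ..
qed

lemma momme_contracts:
  assumes spd: "sym_pos_def A" and xs: "A *v xs = b"
  shows "quad A b c (momme_seq A b c x0 (Suc k)) - quad A b c xs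
    \<le> momme_rate A * (quad A b c (momme_seq A b c x0 k) - quad A b c xs)"
proof -
  obtain prev where "momme A b c x0 (Suc k) = momme_step A b c prev (momme A b c x0 k)"
    and "\<And>p. prev = Some p \<Longrightarrow> momme_sound A b p"
    by (cases k) (auto simp: momme_states_sound[OF spd] intro: that)
  then show ?thesis
    unfolding momme_seq_def using momme_step_sound_contracts(2)[OF spd xs momme_states_sound[OF spd]]
    by simp
qed

lemma momme_linear_rate:
  assumes spd: "sym_pos_def A" and xs: "A *v xs = b"
  shows "quad A b c (momme_seq A b c x0 k) - quad A b c xs
    \<le> momme_rate A ^ k * (quad A b c x0 - quad A b c xs)"
proof (induction k)
  case 0
  show ?case by (simp add: momme_seq_def)
next
  case (Suc k)
  show ?case
    using order_trans[OF momme_contracts[OF spd xs] mult_left_mono[OF Suc momme_rate_nonneg]]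
    by (simp add: mult.assoc)
qed

text \<open>
  The denominator of \<open>\<mu>\<close> vanishes only if the tentative point equals the iterate before the current
  one. But its objective value is strictly below that of the current iterate, which is at most that
  of the iterate before.
\<close>
lemma spd_momme_well_defined:
  fixes A :: "real^'n^'n"
  assumes spd: "sym_pos_def A"
  shows "momme_well_defined A b c x0"
proof -
  obtain xs where xs: "A *v xs = b" using spd_surj[OF spd] by blast
  let ?s = "momme A b c x0" and ?E = "\<lambda>x. quad A b c x - quad A b c xs"
  let ?xt = "\<lambda>k. momme_tilde A b c (iterate (?s k)) (gradient (?s k))"
  have g: "gradient (?s k) = grad_quad A b (iterate (?s k))" for k
    using momme_states_sound[OF spd] by (simp add: momme_sound_def)
  have E: "?E x = 1/2 * ((x - xs) \<bullet> (A *v (x - xs)))" for x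
    by (rule quad_minus_min[OF spd_sym[OF spd] xs])
  have den: "momme_den A b (?xt k) (iterate (?s (k - 1))) (gradient (?s (k - 1))) \<noteq> 0"
    if run: "running (?s k)" and k: "1 \<le> k"
      and ind: "lin_indep_pair (gradient (?s k)) (momme_r A (gradient (?s k)))" for k
  proof -
    have "iterate (?s k) \<noteq> xs"
      using run g grad_quad_eq_0_iff[OF spd xs] by (simp add: running_def)
    then have pos: "0 < ?E (iterate (?s k))"
      unfolding E using spd_pos[OF spd, of "iterate (?s k) - xs"] by simp
    have "?E (?xt k) \<le> momme_rate A * ?E (iterate (?s k))"
      by (rule plane_min_contracts[OF spd xs g ind])
    also have "\<dots> < 1 * ?E (iterate (?s k))"
      by (rule mult_strict_right_mono[OF momme_rate_less_1[OF spd] pos])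
    also have "1 * ?E (iterate (?s k)) = ?E (iterate (?s k))" by (rule mult_1)
    also have "\<dots> \<le> momme_rate A * ?E (iterate (?s (k - 1)))"
      using momme_contracts[OF spd xs, of c x0 "k - 1"] k by (simp add: momme_seq_def)
    also have "\<dots> \<le> 1 * ?E (iterate (?s (k - 1)))"
      using momme_rate_less_1[OF spd] by (intro mult_right_mono) (simp_all add: E spd_nonneg[OF spd])
    finally have "?xt k \<noteq> iterate (?s (k - 1))" by auto
    then show ?thesis using momme_den_pos[OF spd g] by (metis less_irrefl)
  qed
  have "gradient (?s k) \<bullet> (A *v gradient (?s k)) \<noteq> 0" if "running (?s k)" for k
    using spd_pos[OF spd, of "gradient (?s k)"] that by (simp add: running_def)
  then show ?thesis
    unfolding momme_well_defined_def Let_def using den ex1_plane_min[OF spd] by blast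
qed

theorem theorem3p1:
  fixes A :: "real^'n^'n" and b x0 :: "real^'n" and c :: real
  assumes "sym_pos_def A"
  defines "f \<equiv> quad A b c"
    and "x \<equiv> momme_seq A b c x0"
    and "\<kappa> \<equiv> cond_number A"
  shows "momme_well_defined A b c x0 \<and>
    (\<exists>xs. (\<forall>z. is_arg_min f (\<lambda>_. True) z \<longleftrightarrow> z = xs) \<and>
       x \<longlonglongrightarrow> xs \<and>
       (\<exists>\<eta>::real. 0 \<le> \<eta> \<and> \<eta> \<le> (\<kappa> - 1)^4 / (\<kappa>\<^sup>2 + 6 * \<kappa> + 1)\<^sup>2 \<and>
          (\<forall>k. f (x k) - f xs \<le> \<eta>^k * (f x0 - f xs) \<and>
               norm_wrt A (x k - xs) \<le> sqrt (\<eta>^k) * norm_wrt A (x0 - xs))))"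
proof -
  note spd = \<open>sym_pos_def A\<close>
  note sym = spd_sym[OF spd]
  obtain xs where xs: "A *v xs = b" using spd_surj[OF spd] by blast
  let ?\<eta> = "momme_rate A" and ?m = "Min (eigenvalues A)"
  have E: "f z - f xs = 1/2 * ((z - xs) \<bullet> (A *v (z - xs)))" for z
    unfolding f_def by (rule quad_minus_min[OF sym xs])
  have pos: "f xs < f z" if "z \<noteq> xs" for z
    using E[of z] spd_pos[OF spd, of "z - xs"] that by simp
  have argmin: "is_arg_min f (\<lambda>_. True) z \<longleftrightarrow> z = xs" for z
    using pos by (metis is_arg_min_def less_asym less_irrefl)
  have rate: "f (x k) - f xs \<le> ?\<eta> ^ k * (f x0 - f xs)" for k
    unfolding f_def x_def by (rule momme_linear_rate[OF spd xs])
  have form: "(x k - xs) \<bullet> (A *v (x k - xs)) \<le> ?\<eta> ^ k * ((x0 - xs) \<bullet> (A *v (x0 - xs)))" for k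
    using rate[of k] by (simp add: E)
  have norm_rate: "norm_wrt A (x k - xs) \<le> sqrt (?\<eta> ^ k) * norm_wrt A (x0 - xs)" for k
    using real_sqrt_le_mono[OF form[of k]] by (simp only: norm_wrt_def real_sqrt_mult)
  have lim: "x \<longlonglongrightarrow> xs"
  proof -
    define C where "C = (x0 - xs) \<bullet> (A *v (x0 - xs)) / ?m"
    have m: "0 < ?m" by (rule spd_Min_eigenvalue_pos[OF spd])
    have bound: "(norm (x k - xs))\<^sup>2 \<le> C * ?\<eta> ^ k" for k
    proof -
      have "?m * (norm (x k - xs))\<^sup>2 \<le> ?\<eta> ^ k * ((x0 - xs) \<bullet> (A *v (x0 - xs)))"
        using order_trans[OF symmetric_Min_eigenvalue(2)[OF sym] form] by (simp add: dot_square_norm)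
      then show ?thesis using m by (simp add: C_def field_simps)
    qed
    have "(\<lambda>k. C * ?\<eta> ^ k) \<longlonglongrightarrow> 0"
      using momme_rate_nonneg[of A] momme_rate_less_1[OF spd]
      by (intro tendsto_mult_right_zero LIMSEQ_power_zero) simp
    then have "(\<lambda>k. (norm (x k - xs))\<^sup>2) \<longlonglongrightarrow> 0"
      by (rule real_tendsto_sandwich[OF _ _ tendsto_const, rotated 2]) (simp_all add: bound)
    then have "(\<lambda>k. norm (x k - xs)) \<longlonglongrightarrow> 0"
      using tendsto_real_sqrt[of "\<lambda>k. (norm (x k - xs))\<^sup>2" 0] by simp
    then show ?thesis by (simp add: tendsto_norm_zero_iff LIM_zero_iff)
  qed
  have "0 \<le> ?\<eta> \<and> ?\<eta> \<le> (\<kappa> - 1)^4 / (\<kappa>\<^sup>2 + 6 * \<kappa> + 1)\<^sup>2 \<and>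
      (\<forall>k. f (x k) - f xs \<le> ?\<eta> ^ k * (f x0 - f xs) \<and>
        norm_wrt A (x k - xs) \<le> sqrt (?\<eta> ^ k) * norm_wrt A (x0 - xs))"
    using rate norm_rate momme_rate_nonneg[of A] by (simp add: \<kappa>_def momme_rate_def)
  then show ?thesis using spd_momme_well_defined[OF spd] argmin lim by blast
qed

end
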